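(* Let $G$ be a connected graph with $s(G) > \gamma_P(G)\ge 2$. Then for every integer $k\ge 1$, \[\ddot{\gamma}_P^k(G) \le \left\lceil \frac{s(G)\,\bigl(k+\gamma_P(G)-1\bigr)}{s(G)-\gamma_P(G)+1} \right\rceil .\]
   Context: Graphs are finite and simple, with at least one vertex. For a vertex $v$, $N[v]$ denotes its closed neighborhood. The power domination process on a graph $G$ with initial set $S\subseteq V(G)$: (1) set $B=\bigcup_{v\in S}N[v]$; (2) while there is $v\in B$ with exactly one neighbor $u\notin B$, add $u$ to $B$. A set $S$ is a power dominating set of $G$ if $B=V(G)$ when the process terminates. $\gamma_P(G)$ is the minimum cardinality of a power dominating set of $G$. A multiset of vertices is called a power dominating set if its underlying set is one. For an integer $k\ge 0$, a $k$-robust power dominating set of $G$ is a finite multiset $S$ of elements of $V(G)$ with $|S|\ge k$ (counted with multiplicity) such that for every submultiset $F$ of $S$ with $|F|=k$, the multiset difference $S\setminus F$ is a power dominating set of $G$. $\ddot{\gamma}_P^k(G)$ denotes the minimum cardinality (with multiplicity) of a $k$-robust power dominating set of $G$. $s(G)$ denotes the size of the largest set $A\subseteq V(G)$ such that every $B\subseteq A$ with $|B|=\gamma_P(G)$ is a power dominating set of $G$. *)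

theory Defs
  imports Complex_Main "HOL-Library.Multiset" "Graph_Theory.Digraph_Component"
begin

text \<open>
  A finite simple graph is a \<^verbatim>\<open>graph\<close> in the sense of \<^verbatim>\<open>Graph_Theory\<close>: a finite symmetric
  digraph without loops and parallel arcs, each edge being a pair of opposite arcs.
  That locale admits the null graph, but \<^verbatim>\<open>Digraph_Component.connected\<close> excludes it.
\<close>

definition neighborhood :: "('a, 'b) pre_digraph \<Rightarrow> 'a \<Rightarrow> 'a set" where
  "neighborhood G v = {u. v \<rightarrow>\<^bsub>G\<^esub> u}"

definition closed_neighborhood :: "('a, 'b) pre_digraph \<Rightarrow> 'a \<Rightarrow> 'a set" where
  "closed_neighborhood G v = insert v (neighborhood G v)"

definition force_step :: "('a, 'b) pre_digraph \<Rightarrow> 'a set \<Rightarrow> 'a set \<Rightarrow> bool" where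
  "force_step G B B' \<longleftrightarrow> (\<exists>v\<in>B. \<exists>u. neighborhood G v - B = {u} \<and> B' = insert u B)"

definition power_domination_result :: "('a, 'b) pre_digraph \<Rightarrow> 'a set \<Rightarrow> 'a set \<Rightarrow> bool" where
  "power_domination_result G S B \<longleftrightarrow>
     (force_step G)\<^sup>*\<^sup>* (\<Union>v\<in>S. closed_neighborhood G v) B \<and> (\<nexists>B'. force_step G B B')"

text \<open>
  The process makes nondeterministic choices, so the definition asks for some terminating run
  that observes every vertex; \<open>power_domination_result_unique\<close> below shows that all
  terminating runs have the same outcome.
\<close>

definition power_dominating :: "('a, 'b) pre_digraph \<Rightarrow> 'a set \<Rightarrow> bool" where
  "power_dominating G S \<longleftrightarrow> S \<subseteq> verts G \<and> power_domination_result G S (verts G)"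

definition power_domination_number :: "('a, 'b) pre_digraph \<Rightarrow> nat" where
  "power_domination_number G = (LEAST n. \<exists>S. power_dominating G S \<and> card S = n)"

definition robust_power_dominating :: "('a, 'b) pre_digraph \<Rightarrow> nat \<Rightarrow> 'a multiset \<Rightarrow> bool" where
  "robust_power_dominating G k S \<longleftrightarrow>
     set_mset S \<subseteq> verts G \<and> size S \<ge> k \<and>
     (\<forall>F. F \<subseteq># S \<and> size F = k \<longrightarrow> power_dominating G (set_mset (S - F)))"

definition robust_power_domination_number :: "('a, 'b) pre_digraph \<Rightarrow> nat \<Rightarrow> nat" where
  "robust_power_domination_number G k =
     (LEAST n. \<exists>S. robust_power_dominating G k S \<and> size S = n)"

definition interchangeable_set_number :: "('a, 'b) pre_digraph \<Rightarrow> nat" where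
  "interchangeable_set_number G =
     Max {card A | A. A \<subseteq> verts G \<and>
            (\<forall>B. B \<subseteq> A \<and> card B = power_domination_number G \<longrightarrow> power_dominating G B)}"

lemma force_steps_subset_final:
  assumes "(force_step G)\<^sup>*\<^sup>* X C" and "X \<subseteq> B" and final: "\<nexists>B'. force_step G B B'"
  shows "C \<subseteq> B"
  using assms(1,2)
proof (induction rule: rtranclp_induct)
  case base
  then show ?case .
next
  case (step C D)
  then have CB: "C \<subseteq> B" by blast
  from step.hyps obtain v u where vu: "v \<in> C" "neighborhood G v - C = {u}" "D = insert u C"
    by (auto simp: force_step_def)
  have "u \<in> B"
  proof (rule ccontr)
    assume "u \<notin> B"
    with vu CB have "v \<in> B" "neighborhood G v - B = {u}" by blast+
    with final show False by (auto simp: force_step_def)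
  qed
  with CB vu show ?case by simp
qed

lemma force_steps_increasing: "(force_step G)\<^sup>*\<^sup>* X C \<Longrightarrow> X \<subseteq> C"
  by (induction rule: rtranclp_induct) (auto simp: force_step_def)

lemma power_domination_result_unique:
  assumes "power_domination_result G S B" and "power_domination_result G S C"
  shows "B = C"
  using assms unfolding power_domination_result_def
  by (meson force_steps_increasing force_steps_subset_final subset_antisym)

end

theory Submission
  imports Defs
begin

text \<open>
  Write \<open>s\<close> for \<open>s(G)\<close> and \<open>p\<close> for the power domination number. Spread \<open>N\<close> pebbles, where \<open>N\<close> is
  the right-hand side of the bound, as evenly as possible over an optimal interchangeable set \<open>A\<close>
  of size \<open>s\<close>. A submultiset that meets fewer than \<open>p\<close> vertices has at most as many pebbles as the
  \<open>p - 1\<close> fullest vertices carry together, and the choice of \<open>N\<close> makes this less than \<open>N - k\<close>.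
  So after any removal of \<open>k\<close> pebbles at least \<open>p\<close> vertices of \<open>A\<close> remain occupied. They contain
  a power dominating set, and supersets of power dominating sets are power dominating.
\<close>

lemma force_steps_verts:
  assumes "wf_digraph G" and "(force_step G)\<^sup>*\<^sup>* X B" and "X \<subseteq> verts G"
  shows "B \<subseteq> verts G"
  using assms(2,3)
proof (induction rule: rtranclp_induct)
  case (step C D)
  then obtain v u where "neighborhood G v - C = {u}" "D = insert u C" and C: "C \<subseteq> verts G"
    by (auto simp: force_step_def)
  moreover from this have "v \<rightarrow>\<^bsub>G\<^esub> u" by (auto simp: neighborhood_def)
  ultimately show ?case using wf_digraph.adj_in_verts[OF assms(1)] by blast
qed

lemma force_steps_terminate:
  assumes "wf_digraph G" and "finite (verts G)" and "X \<subseteq> verts G"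
  shows "\<exists>B. (force_step G)\<^sup>*\<^sup>* X B \<and> (\<nexists>B'. force_step G B B')"
  using assms(3)
proof (induction "card (verts G - X)" arbitrary: X rule: less_induct)
  case less
  show ?case
  proof (cases "\<exists>X'. force_step G X X'")
    case True
    then obtain X' where X': "force_step G X X'" ..
    then have "X \<subset> X'" by (auto simp: force_step_def)
    moreover have sub: "X' \<subseteq> verts G"
      using force_steps_verts[OF assms(1) r_into_rtranclp] X' less.prems by metis
    ultimately have "card (verts G - X') < card (verts G - X)"
      using assms(2) by (intro psubset_card_mono) auto
    from less.hyps[OF this sub] show ?thesis
      using X' by (meson converse_rtranclp_into_rtranclp)
  qed auto
qed

text \<open>A terminated run from \<open>T\<close> exists by finiteness. Its final set admits no
  further force and contains the start of the run from \<open>S\<close>, so it absorbs everything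
  that run observes.\<close>

lemma power_dominating_mono:
  assumes "wf_digraph G" and "finite (verts G)" and "power_dominating G S"
    and "S \<subseteq> T" and "T \<subseteq> verts G"
  shows "power_dominating G T"
proof -
  let ?N = "\<lambda>S. \<Union>v\<in>S. closed_neighborhood G v"
  have NT: "?N T \<subseteq> verts G"
    using assms(5) wf_digraph.adj_in_verts[OF assms(1)]
    by (auto simp: closed_neighborhood_def neighborhood_def)
  from force_steps_terminate[OF assms(1,2) this]
  obtain B where B: "(force_step G)\<^sup>*\<^sup>* (?N T) B" "\<nexists>B'. force_step G B B'" by blast
  have "?N S \<subseteq> B" using force_steps_increasing[OF B(1)] assms(4) by blast
  moreover have "(force_step G)\<^sup>*\<^sup>* (?N S) (verts G)"
    using assms(3) by (simp add: power_dominating_def power_domination_result_def)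
  ultimately have "verts G \<subseteq> B" using force_steps_subset_final B(2) by blast
  with force_steps_verts[OF assms(1) B(1) NT] have "B = verts G" by blast
  with B assms(5) show ?thesis
    by (simp add: power_dominating_def power_domination_result_def)
qed

lemma interchangeable_set_obtain:
  assumes "finite (verts G)" and "power_domination_number G \<noteq> 0"
  obtains A where "A \<subseteq> verts G" and "card A = interchangeable_set_number G"
    and "\<And>B. B \<subseteq> A \<Longrightarrow> card B = power_domination_number G \<Longrightarrow> power_dominating G B"
proof -
  let ?P = "\<lambda>A. A \<subseteq> verts G \<and>
    (\<forall>B. B \<subseteq> A \<and> card B = power_domination_number G \<longrightarrow> power_dominating G B)"
  let ?C = "{card A | A. ?P A}"
  have "finite ?C" using assms(1) by simp
  \<comment> \<open>As the power domination number is nonzero, no subset of \<open>{}\<close> has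
    that size, and the condition holds vacuously.\<close>
  moreover have "?P {}" using assms(2) by auto
  then have "?C \<noteq> {}" by blast
  ultimately have "Max ?C \<in> ?C" by (rule Max_in)
  then obtain A where "?P A" "card A = interchangeable_set_number G"
    unfolding interchangeable_set_number_def by (smt (verit) mem_Collect_eq)
  then show thesis using that by blast
qed

text \<open>Each vertex occurring in \<open>M\<close> carries at most \<open>q\<close> pebbles, plus
  one more if it lies in \<open>R\<close>. The extra pebbles thus number at most both the occupied
  vertices and \<open>card R\<close>.\<close>

lemma size_subset_repeat_mset:
  assumes "M \<subseteq># repeat_mset q (mset_set A) + mset_set R" and "finite A" and "finite R"
  shows "size M \<le> q * card (set_mset M) + min (card (set_mset M)) (card R)"
proof -
  let ?T = "set_mset M"
  have "M \<subseteq># repeat_mset q (mset_set ?T) + mset_set (R \<inter> ?T)"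
  proof (rule mset_subset_eqI)
    fix a
    have "count M a \<le> q * count (mset_set A) a + count (mset_set R) a"
      using mset_subset_eq_count[OF assms(1), of a] by simp
    then show "count M a \<le> count (repeat_mset q (mset_set ?T) + mset_set (R \<inter> ?T)) a"
      using assms(2,3) by (cases "a \<in># M") (auto simp: count_mset_set' not_in_iff split: if_splits)
  qed
  from size_mset_mono[OF this] have "size M \<le> q * card ?T + card (R \<inter> ?T)"
    by simp
  also have "card (R \<inter> ?T) \<le> min (card ?T) (card R)"
    using assms(3) by (simp add: card_mono)
  finally show ?thesis by simp
qed

text \<open>Here \<open>m + d\<close> is the number of vertices, and \<open>q * m + min m r\<close>
  is the load of the \<open>m\<close> fullest ones. The first assumption is the bound on the number
  of pebbles, cleared of its denominator \<open>d\<close>.\<close>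

lemma pebbles_on_fullest:
  fixes q r m d k :: nat
  assumes "(q * (m + d) + r) * d \<ge> (m + d) * (k + m)" and "m \<ge> 1"
  shows "q * m + min m r + k < q * (m + d) + r"
proof (rule ccontr)
  assume "\<not> ?thesis"
  then have "q * d + r \<le> k + min m r" by (simp add: algebra_simps)
  \<comment> \<open>The left side equals \<open>(q * (m + d) + r) * d + r * m\<close>, which brings
    in the first assumption and leaves the surplus \<open>r * m\<close>. That surplus must vanish,
    and then \<open>r = 0\<close> makes \<open>min m r\<close> too small.\<close>
  then have "(m + d) * (q * d + r) \<le> (m + d) * (k + min m r)" by (rule mult_le_mono2)
  with assms(1) have le: "(m + d) * m + r * m \<le> (m + d) * min m r"
    by (simp add: algebra_simps)
  moreover have "(m + d) * min m r \<le> (m + d) * m" by simp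
  ultimately have "r * m = 0" by linarith
  with assms(2) have "r = 0" by simp
  with le assms(2) show False by simp
qed

lemma robust_power_dominating_balanced:
  assumes "wf_digraph G" and "finite (verts G)"
    and A: "A \<subseteq> verts G" "\<And>B. B \<subseteq> A \<Longrightarrow> card B = Suc m \<Longrightarrow> power_dominating G B"
    and "card A = m + d" and "d > 0" and "m \<ge> 1"
    and N: "N * d \<ge> (m + d) * (k + m)"
  shows "\<exists>S. robust_power_dominating G k S \<and> size S = N"
proof -
  define q r where "q = N div (m + d)" and "r = N mod (m + d)"
  have N_eq: "N = q * (m + d) + r" unfolding q_def r_def by (rule div_mult_mod_eq[symmetric])
  have finA: "finite A" using assms(2) A(1) finite_subset by blast
  have "r \<le> card A" using assms(5,6) by (simp add: r_def less_imp_le)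
  then obtain R where R: "R \<subseteq> A" "card R = r" by (rule obtain_subset_with_card_n)
  have finR: "finite R" using R(1) finA finite_subset by blast
  \<comment> \<open>\<open>R\<close> holds the vertices that receive one of the \<open>r\<close>
    leftover pebbles.\<close>
  define S where "S = repeat_mset q (mset_set A) + mset_set R"
  have sizeS: "size S = N" by (simp add: S_def N_eq assms(5) R(2))
  have setS: "set_mset S \<subseteq> A"
    using R(1) finA finR
    by (auto simp: S_def count_mset_set' simp flip: count_greater_zero_iff split: if_splits)
  have many: "q * m + min m r + k < N"
    using pebbles_on_fullest N assms(7) N_eq by blast
  have "power_dominating G (set_mset (S - F))" if F: "F \<subseteq># S" "size F = k" for F
  proof -
    let ?T = "set_mset (S - F)"
    have "Suc m \<le> card ?T"
    proof (rule ccontr)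
      assume "\<not> ?thesis"
      then have T: "card ?T \<le> m" by simp
      have "S - F \<subseteq># repeat_mset q (mset_set A) + mset_set R" unfolding S_def by simp
      from size_subset_repeat_mset[OF this finA finR]
      have "size (S - F) \<le> q * card ?T + min (card ?T) r" by (simp add: R(2))
      also have "\<dots> \<le> q * m + min m r" using T by (intro add_mono mult_le_mono2) auto
      finally show False using many sizeS size_Diff_submset[OF F(1)] F(2) by simp
    qed
    then obtain B where B: "B \<subseteq> ?T" "card B = Suc m" by (rule obtain_subset_with_card_n)
    have "?T \<subseteq> A" using setS by (meson in_diffD subset_iff)
    with A B show ?thesis by (intro power_dominating_mono[OF assms(1,2) _ B(1)]) auto
  qed
  \<comment> \<open>Besides its use above, \<open>many\<close> gives \<open>k < N\<close>, hence the
    required \<open>size S \<ge> k\<close>.\<close>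
  with setS A(1) sizeS many have "robust_power_dominating G k S"
    by (auto simp: robust_power_dominating_def)
  with sizeS show ?thesis by blast
qed

theorem theorem3p10:
  fixes G :: "('a, 'b) pre_digraph" and k :: nat
  assumes "graph G"
    and "Digraph_Component.connected G"
    and "interchangeable_set_number G > power_domination_number G"
    and "power_domination_number G \<ge> 2"
    and "k \<ge> 1"
  shows "int (robust_power_domination_number G k) \<le>
    \<lceil>real (interchangeable_set_number G) * (real k + real (power_domination_number G) - 1)
      / (real (interchangeable_set_number G) - real (power_domination_number G) + 1)\<rceil>"
proof -
  interpret graph G by fact
  \<comment> \<open>\<open>m\<close> is the largest number of occupied vertices that is too small,
    and \<open>d\<close> is the denominator of the bound, so later steps avoid truncated
    subtraction.\<close>
  define m where "m = power_domination_number G - 1"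
  define d where "d = interchangeable_set_number G - m"
  have p: "power_domination_number G = Suc m" and s: "interchangeable_set_number G = m + d"
    and "d > 0" "m \<ge> 1"
    using assms(3,4) by (auto simp: m_def d_def)
  define x where "x = real (m + d) * (real k + real m) / real d"
  define N where "N = nat \<lceil>x\<rceil>"
  have "x \<ge> 0" by (simp add: x_def)
  then have N: "int N = \<lceil>x\<rceil>" by (simp add: N_def)
  have "x \<le> real N" unfolding N_def by (rule real_nat_ceiling_ge)
  then have "real (m + d) * (real k + real m) \<le> real N * real d"
    using \<open>d > 0\<close> by (simp add: x_def pos_divide_le_eq)
  then have N_ge: "N * d \<ge> (m + d) * (k + m)"
    by (simp flip: of_nat_add of_nat_mult)
  obtain A where "A \<subseteq> verts G" "card A = m + d"
    "\<And>B. B \<subseteq> A \<Longrightarrow> card B = Suc m \<Longrightarrow> power_dominating G B"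
    using interchangeable_set_obtain[of G] p s by auto
  then have "\<exists>S. robust_power_dominating G k S \<and> size S = N"
    using robust_power_dominating_balanced[OF wf_digraph_axioms finite_verts]
      \<open>d > 0\<close> \<open>m \<ge> 1\<close> N_ge by blast
  then have "robust_power_domination_number G k \<le> N"
    unfolding robust_power_domination_number_def by (rule Least_le)
  then have "int (robust_power_domination_number G k) \<le> \<lceil>x\<rceil>" using N by linarith
  then show ?thesis by (simp add: x_def p s)
qed

end
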